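(* Consider the max-plus algebra over $S = \mathbb{N}_0 \cup \{-\infty\}$ equipped with addition $x \oplus y = \max(x,y)$ and multiplication $x \odot y = x + y$. Then the following statements hold: (1) The ideals of $S$ are exactly \[ I_n = \{k \in \mathbb{N}_0 \mid k \ge n\} \cup \{-\infty\}, \quad n \in \mathbb{N}_0, \] together with the zero ideal $I_{-\infty} = \{-\infty\}$. These ideals form a chain: \[ I_{-\infty} \subset \cdots \subset I_3 \subset I_2 \subset I_1 \subset I_0 = S. \] In particular, $S$ is both Kuratowski and nucleus. (2) $S$ is an austere information algebra. In particular, the subtractive closure $\operatorname{scl}_S$ distributes over ideal multiplication, i.e., $\operatorname{scl}_S(I)\odot\operatorname{scl}_S(J)=\operatorname{scl}_S(I\odot J)$ for all ideals $I,J$ of $S$.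
   Context: Here $-\infty\le x$ and $x+(-\infty)=-\infty$ for all $x\in S$; the zero (additive identity) of $S$ is $-\infty$ and its multiplicative identity is the integer $0$. An ideal of a commutative semiring $S$ (with operations $\oplus,\odot$) is a nonempty subset $I$ with $a\oplus b\in I$ and $s\odot a\in I$ for all $a,b\in I$, $s\in S$. An ideal $I$ is subtractive if $x\oplus y\in I$ and $x\in I$ imply $y\in I$, for all $x,y\in S$. $\operatorname{Id}(S)$ is the lattice of ideals of $S$ ordered by inclusion, whose least element is the zero ideal, with join $\{i\oplus j:i\in I,j\in J\}$ and meet $I\cap J$. The product $I\odot J$ of ideals is the set of all finite $\oplus$-sums of elements $i\odot j$, $i\in I$, $j\in J$. $\operatorname{scl}_S(I)$ is the intersection of all subtractive ideals of $S$ containing $I$. $S$ is austere if its only subtractive ideals are the zero ideal and $S$. $S$ is an information algebra if it is a semiring (with multiplicative identity different from zero) that is zerosumfree ($a\oplus b$ is zero only if $a$ and $b$ are both zero) and entire ($a\odot b$ is zero only if $a$ or $b$ is zero). A Kuratowski map on a join-semilattice $(P,\le)$ with least element $0_P$ is a function $k:P\to P$ with $x\le k(x)$, $k(k(x))=k(x)$, $k(0_P)=0_P$ and $k(x\vee y)=k(x)\vee k(y)$ for all $x,y$. A nucleus map on a meet-semilattice $(P,\le)$ is a function $\nu:P\to P$ with $x\le\nu(x)$, $\nu(\nu(x))=\nu(x)$ and $\nu(x\wedge y)=\nu(x)\wedge\nu(y)$ for all $x,y$. $S$ is Kuratowski (respectively nucleus) if $\operatorname{scl}_S$ is a Kuratowski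 map (respectively a nucleus map) on $\operatorname{Id}(S)$. *)

theory Defs
  imports "HOL-Algebra.Ring" "HOL-Algebra.Lattice" "HOL-Library.Extended"
begin

text \<open>
  Semirings are records in the sense of \<open>HOL-Algebra\<close>. Commutativity of the multiplication is
  the additional assumption \<^const>\<open>comm_monoid\<close>.
\<close>

locale information_algebra = semiring R + comm_monoid R for R (structure) +
  assumes one_not_zero: "\<one> \<noteq> \<zero>"
    and zerosumfree:
      "\<lbrakk>a \<in> carrier R; b \<in> carrier R; a \<oplus> b = \<zero>\<rbrakk> \<Longrightarrow> a = \<zero> \<and> b = \<zero>"
    and entire:
      "\<lbrakk>a \<in> carrier R; b \<in> carrier R; a \<otimes> b = \<zero>\<rbrakk> \<Longrightarrow> a = \<zero> \<or> b = \<zero>"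

text \<open>
  The library's \<open>ideal\<close> is about rings and demands closure under negation, so it does not apply here.
\<close>

definition semiring_ideal :: "('a, 'm) ring_scheme \<Rightarrow> 'a set \<Rightarrow> bool" where
  "semiring_ideal R I \<longleftrightarrow> I \<noteq> {} \<and> I \<subseteq> carrier R \<and>
     (\<forall>a\<in>I. \<forall>b\<in>I. a \<oplus>\<^bsub>R\<^esub> b \<in> I) \<and>
     (\<forall>s\<in>carrier R. \<forall>a\<in>I. s \<otimes>\<^bsub>R\<^esub> a \<in> I)"

definition subtractive_ideal :: "('a, 'm) ring_scheme \<Rightarrow> 'a set \<Rightarrow> bool" where
  "subtractive_ideal R I \<longleftrightarrow> semiring_ideal R I \<and>
     (\<forall>x\<in>carrier R. \<forall>y\<in>carrier R. x \<oplus>\<^bsub>R\<^esub> y \<in> I \<longrightarrow> x \<in> I \<longrightarrow> y \<in> I)"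

definition scl :: "('a, 'm) ring_scheme \<Rightarrow> 'a set \<Rightarrow> 'a set" where
  "scl R I = \<Inter>{J. subtractive_ideal R J \<and> I \<subseteq> J}"

definition ideal_mult :: "('a, 'm) ring_scheme \<Rightarrow> 'a set \<Rightarrow> 'a set \<Rightarrow> 'a set" where
  "ideal_mult R I J =
     {\<Oplus>\<^bsub>R\<^esub>k\<in>{..<n}. i k \<otimes>\<^bsub>R\<^esub> j k | (n::nat) i j.
        i \<in> {..<n} \<rightarrow> I \<and> j \<in> {..<n} \<rightarrow> J}"

definition austere :: "('a, 'm) ring_scheme \<Rightarrow> bool" where
  "austere R \<longleftrightarrow> {I. subtractive_ideal R I} = {{\<zero>\<^bsub>R\<^esub>}, carrier R}"

definition ideal_order :: "('a, 'm) ring_scheme \<Rightarrow> 'a set gorder" where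
  "ideal_order R = \<lparr>carrier = {I. semiring_ideal R I}, eq = (=), le = (\<subseteq>)\<rparr>"

text \<open>
  For the ideals of a commutative semiring, the order-theoretic least element, join and meet
  are the zero ideal, the sum of ideals and the intersection.
\<close>

lemma ideal_order_simps [simp]:
  "carrier (ideal_order R) = {I. semiring_ideal R I}"
  "eq (ideal_order R) = (=)"
  "le (ideal_order R) = (\<subseteq>)"
  by (simp_all add: ideal_order_def)

lemma partial_order_ideal_order: "partial_order (ideal_order R)"
  by unfold_locales auto

context
  fixes R (structure)
  assumes semiring: "semiring R" and comm_monoid: "comm_monoid R"
begin

interpretation semiring R by (rule semiring)
interpretation comm_monoid R by (rule comm_monoid)

lemma zero_in_semiring_ideal:
  assumes "semiring_ideal R I" shows "\<zero> \<in> I"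
proof -
  from assms obtain a where "a \<in> I" "a \<in> carrier R" by (auto simp: semiring_ideal_def)
  with assms show ?thesis by (metis l_null semiring_ideal_def zero_closed)
qed

lemma least_ideal_order: "least (ideal_order R) {\<zero>} (carrier (ideal_order R))"
  by (auto simp: least_def zero_in_semiring_ideal) (simp add: semiring_ideal_def)

lemma least_Upper_ideal_order:
  assumes I: "semiring_ideal R I" and J: "semiring_ideal R J"
  shows "least (ideal_order R) {i \<oplus> j | i j. i \<in> I \<and> j \<in> J} (Upper (ideal_order R) {I, J})"
    (is "least _ ?S _")
proof -
  have c: "i \<in> carrier R" if "i \<in> I \<or> i \<in> J" for i
    using that I J by (auto simp: semiring_ideal_def)
  have "semiring_ideal R ?S"
    unfolding semiring_ideal_def
  proof (intro conjI ballI)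
    show "?S \<noteq> {}" using zero_in_semiring_ideal[OF I] zero_in_semiring_ideal[OF J] by blast
    show "?S \<subseteq> carrier R" using c by auto
  next
    fix a b assume "a \<in> ?S" "b \<in> ?S"
    then obtain i j i' j' where *: "a = i \<oplus> j" "b = i' \<oplus> j'" "i \<in> I" "i' \<in> I" "j \<in> J" "j' \<in> J"
      by blast
    then have "a \<oplus> b = (i \<oplus> i') \<oplus> (j \<oplus> j')" using c by (simp add: add.m_ac)
    moreover have "i \<oplus> i' \<in> I" "j \<oplus> j' \<in> J" using * I J by (auto simp: semiring_ideal_def)
    ultimately show "a \<oplus> b \<in> ?S" by blast
  next
    fix s a assume s: "s \<in> carrier R" and "a \<in> ?S"
    then obtain i j where *: "a = i \<oplus> j" "i \<in> I" "j \<in> J" by blast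
    then have "s \<otimes> a = s \<otimes> i \<oplus> s \<otimes> j" using c s by (simp add: r_distr)
    moreover have "s \<otimes> i \<in> I" "s \<otimes> j \<in> J" using * I J s by (auto simp: semiring_ideal_def)
    ultimately show "s \<otimes> a \<in> ?S" by blast
  qed
  moreover have "I \<subseteq> ?S"
  proof
    fix i assume "i \<in> I"
    moreover from this have "i = i \<oplus> \<zero>" using c by simp
    ultimately show "i \<in> ?S" using zero_in_semiring_ideal[OF J] by blast
  qed
  moreover have "J \<subseteq> ?S"
  proof
    fix j assume "j \<in> J"
    moreover from this have "j = \<zero> \<oplus> j" using c by simp
    ultimately show "j \<in> ?S" using zero_in_semiring_ideal[OF I] by blast
  qed
  moreover have "?S \<subseteq> K" if "semiring_ideal R K" "I \<subseteq> K" "J \<subseteq> K" for K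
    using that unfolding semiring_ideal_def by blast
  ultimately show ?thesis using I J unfolding least_def Upper_def by auto
qed

lemma greatest_Lower_ideal_order:
  assumes I: "semiring_ideal R I" and J: "semiring_ideal R J"
  shows "greatest (ideal_order R) (I \<inter> J) (Lower (ideal_order R) {I, J})"
proof -
  have "semiring_ideal R (I \<inter> J)"
    using assms zero_in_semiring_ideal[OF I] zero_in_semiring_ideal[OF J]
    unfolding semiring_ideal_def by blast
  then show ?thesis using I J unfolding greatest_def Lower_def by auto
qed

lemma lattice_ideal_order: "lattice (ideal_order R)"
proof -
  interpret partial_order "ideal_order R" by (rule partial_order_ideal_order)
  show ?thesis
    by unfold_locales
      (use least_Upper_ideal_order greatest_Lower_ideal_order in \<open>simp; blast\<close>)+
qed

lemma bottom_ideal_order: "\<bottom>\<^bsub>ideal_order R\<^esub> = {\<zero>}"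
proof -
  interpret partial_order "ideal_order R" by (rule partial_order_ideal_order)
  show ?thesis
    unfolding bottom_def using least_ideal_order by (metis (no_types) least_unique someI_ex)
qed

lemma join_ideal_order:
  assumes "semiring_ideal R I" "semiring_ideal R J"
  shows "I \<squnion>\<^bsub>ideal_order R\<^esub> J = {i \<oplus> j | i j. i \<in> I \<and> j \<in> J}"
proof -
  interpret partial_order "ideal_order R" by (rule partial_order_ideal_order)
  show ?thesis
    unfolding join_def sup_def using least_Upper_ideal_order[OF assms]
    by (metis (no_types, lifting) least_unique someI_ex)
qed

lemma meet_ideal_order:
  assumes "semiring_ideal R I" "semiring_ideal R J"
  shows "I \<sqinter>\<^bsub>ideal_order R\<^esub> J = I \<inter> J"
proof -
  interpret partial_order "ideal_order R" by (rule partial_order_ideal_order)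
  show ?thesis
    unfolding meet_def inf_def using greatest_Lower_ideal_order[OF assms]
    by (metis (no_types, lifting) greatest_unique someI_ex)
qed

end

locale kuratowski_map = upper_semilattice P + weak_partial_order_bottom P for P (structure) +
  fixes k
  assumes maps: "k \<in> carrier P \<rightarrow> carrier P"
    and extensive: "x \<in> carrier P \<Longrightarrow> x \<sqsubseteq> k x"
    and idempotent: "x \<in> carrier P \<Longrightarrow> k (k x) = k x"
    and preserves_bottom: "k \<bottom> = \<bottom>"
    and preserves_join:
      "\<lbrakk>x \<in> carrier P; y \<in> carrier P\<rbrakk> \<Longrightarrow> k (x \<squnion> y) = k x \<squnion> k y"

locale nucleus_map = lower_semilattice P for P (structure) +
  fixes \<nu>
  assumes maps: "\<nu> \<in> carrier P \<rightarrow> carrier P"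
    and extensive: "x \<in> carrier P \<Longrightarrow> x \<sqsubseteq> \<nu> x"
    and idempotent: "x \<in> carrier P \<Longrightarrow> \<nu> (\<nu> x) = \<nu> x"
    and preserves_meet:
      "\<lbrakk>x \<in> carrier P; y \<in> carrier P\<rbrakk> \<Longrightarrow> \<nu> (x \<sqinter> y) = \<nu> x \<sqinter> \<nu> y"

definition kuratowski :: "('a, 'm) ring_scheme \<Rightarrow> bool" where
  "kuratowski R \<longleftrightarrow> kuratowski_map (ideal_order R) (scl R)"

definition nucleus :: "('a, 'm) ring_scheme \<Rightarrow> bool" where
  "nucleus R \<longleftrightarrow> nucleus_map (ideal_order R) (scl R)"

text \<open>
  \<^typ>\<open>nat extended\<close> also contains \<^const>\<open>Pinf\<close>, which is left out of the carrier.
\<close>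

definition max_plus :: "nat extended ring" where
  "max_plus =
     \<lparr>carrier = range Fin \<union> {Minf}, mult = (+), one = Fin 0, zero = Minf, add = max\<rparr>"

definition max_plus_ideal :: "nat \<Rightarrow> nat extended set" where
  "max_plus_ideal n = {Fin k | k. k \<ge> n} \<union> {Minf}"

end

theory Submission
  imports Defs
begin

text \<open>
  Every nonzero ideal of an austere semiring has subtractive closure the whole semiring.
  Over an information algebra, \<open>I + J\<close> is zero iff both \<open>I\<close> and \<open>J\<close> are, while \<open>I \<inter> J\<close> and \<open>I J\<close>
  are zero iff one of \<open>I\<close>, \<open>J\<close> is; hence the closure is a Kuratowski and a nucleus map and
  distributes over products. The max-plus algebra is austere because a nonzero ideal contains some
  \<open>Fin n\<close>, and then \<open>max y (Fin n) = Fin n\<close> forces every \<open>y \<le> Fin n\<close> into its subtractive closure.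
\<close>

section \<open>Austere information algebras\<close>

text \<open>The intersection ranges over at most two sets, and the zero ideal takes part exactly
  when it contains \<open>I\<close>. Only \<open>I \<subseteq> carrier R\<close> is assumed, so the
  lemma also applies to a product of ideals before that product is known to be an ideal.\<close>

lemma scl_austere:
  assumes "austere R" and "\<zero>\<^bsub>R\<^esub> \<in> carrier R" and "I \<subseteq> carrier R"
  shows "scl R I = (if I \<subseteq> {\<zero>\<^bsub>R\<^esub>} then {\<zero>\<^bsub>R\<^esub>} else carrier R)"
proof -
  have "subtractive_ideal R J \<longleftrightarrow> J = {\<zero>\<^bsub>R\<^esub>} \<or> J = carrier R" for J
    using assms(1) by (auto simp: austere_def set_eq_iff[of "Collect _"])
  then have "{J. subtractive_ideal R J \<and> I \<subseteq> J}
      = (if I \<subseteq> {\<zero>\<^bsub>R\<^esub>} then {{\<zero>\<^bsub>R\<^esub>}, carrier R} else {carrier R})"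
    using assms(3) by auto
  then show ?thesis using assms(2) by (auto simp: scl_def)
qed

context information_algebra
begin

lemma semiring_ideal_zero: "semiring_ideal R {\<zero>}"
  by (simp add: semiring_ideal_def)

lemma semiring_ideal_carrier: "semiring_ideal R (carrier R)"
  \<comment> \<open>As a simp rule, \<open>zero_closed\<close> would reduce the inserted fact to
    \<open>True\<close>; it has to survive as the witness of nonemptiness.\<close>
  using zero_closed by (auto simp: semiring_ideal_def simp del: zero_closed)

lemma zero_mem_ideal: "semiring_ideal R I \<Longrightarrow> \<zero> \<in> I"
  by (rule zero_in_semiring_ideal[OF semiring_axioms comm_monoid_axioms])

section \<open>Products, intersections and sums of ideals: when they vanish\<close>

lemma ideal_mult_subset_carrier:
  assumes "I \<subseteq> carrier R" "J \<subseteq> carrier R"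
  shows "ideal_mult R I J \<subseteq> carrier R"
proof -
  have "(\<Oplus>k\<in>{..<n}. i k \<otimes> j k) \<in> carrier R"
    if "i \<in> {..<n} \<rightarrow> I" "j \<in> {..<n} \<rightarrow> J" for n :: nat and i j
    using that assms by (intro finsum_closed) (auto simp: Pi_iff subset_iff)
  then show ?thesis by (auto simp: ideal_mult_def)
qed

text \<open>A single product is a sum of length one, given by constant families.\<close>

lemma mult_mem_ideal_mult:
  assumes "a \<in> I" "b \<in> J" "a \<in> carrier R" "b \<in> carrier R"
  shows "a \<otimes> b \<in> ideal_mult R I J"
proof -
  have "a \<otimes> b = (\<Oplus>k\<in>{..<1::nat}. a \<otimes> b)"
    using assms(3,4) by (simp add: lessThan_Suc)
  then show ?thesis
    unfolding ideal_mult_def using assms(1,2)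
    by (intro CollectI exI[of _ "1::nat"] exI[of _ "\<lambda>_. a"] exI[of _ "\<lambda>_. b"]) auto
qed

lemma ideal_mult_carrier: "ideal_mult R (carrier R) (carrier R) = carrier R"
proof
  show "carrier R \<subseteq> ideal_mult R (carrier R) (carrier R)"
    using mult_mem_ideal_mult[of _ "carrier R" \<one> "carrier R"] by auto
qed (simp add: ideal_mult_subset_carrier)

text \<open>Nonzero elements of \<open>I\<close> and \<open>J\<close> have a nonzero product because
  the semiring is entire. Conversely, if one ideal is zero, every summand has a zero factor.\<close>

lemma ideal_mult_subset_zero_iff:
  assumes I: "semiring_ideal R I" and J: "semiring_ideal R J"
  shows "ideal_mult R I J \<subseteq> {\<zero>} \<longleftrightarrow> I \<subseteq> {\<zero>} \<or> J \<subseteq> {\<zero>}"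
proof
  have c: "I \<subseteq> carrier R" "J \<subseteq> carrier R"
    using I J by (auto simp: semiring_ideal_def)
  show "I \<subseteq> {\<zero>} \<or> J \<subseteq> {\<zero>}" if "ideal_mult R I J \<subseteq> {\<zero>}"
  proof (rule ccontr)
    assume "\<not> (I \<subseteq> {\<zero>} \<or> J \<subseteq> {\<zero>})"
    then obtain a b where "a \<in> I" "a \<noteq> \<zero>" "b \<in> J" "b \<noteq> \<zero>" by auto
    then show False
      using that mult_mem_ideal_mult[of a I b J] entire[of a b] c by auto
  qed
  show "ideal_mult R I J \<subseteq> {\<zero>}" if "I \<subseteq> {\<zero>} \<or> J \<subseteq> {\<zero>}"
  proof -
    have "(\<Oplus>k\<in>{..<n}. i k \<otimes> j k) = \<zero>"
      if "i \<in> {..<n} \<rightarrow> I" "j \<in> {..<n} \<rightarrow> J" for n :: nat and i j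
    proof -
      have "i k \<otimes> j k = \<zero>" if "k \<in> {..<n}" for k
      proof -
        have "i k \<in> I" "j k \<in> J"
          using that \<open>i \<in> _\<close> \<open>j \<in> _\<close> by auto
        then have "i k = \<zero> \<or> j k = \<zero>" "i k \<in> carrier R" "j k \<in> carrier R"
          using \<open>I \<subseteq> {\<zero>} \<or> J \<subseteq> {\<zero>}\<close> c by blast+
        then show ?thesis by (elim disjE) simp_all
      qed
      then have "(\<Oplus>k\<in>{..<n}. i k \<otimes> j k) = (\<Oplus>k\<in>{..<n}. \<zero>)"
        by (intro finsum_cong') auto
      then show ?thesis by simp
    qed
    then show ?thesis by (auto simp: ideal_mult_def)
  qed
qed

text \<open>For nonzero \<open>a\<close> in \<open>I\<close> and \<open>b\<close> in
  \<open>J\<close>, the product \<open>a \<otimes> b\<close> lies in both ideals by absorption and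
  commutativity, and it is nonzero since the semiring is entire.\<close>

lemma inter_subset_zero_iff:
  assumes I: "semiring_ideal R I" and J: "semiring_ideal R J"
  shows "I \<inter> J \<subseteq> {\<zero>} \<longleftrightarrow> I \<subseteq> {\<zero>} \<or> J \<subseteq> {\<zero>}"
proof
  show "I \<subseteq> {\<zero>} \<or> J \<subseteq> {\<zero>}" if "I \<inter> J \<subseteq> {\<zero>}"
  proof (rule ccontr)
    assume "\<not> (I \<subseteq> {\<zero>} \<or> J \<subseteq> {\<zero>})"
    then obtain a b where ab: "a \<in> I" "a \<noteq> \<zero>" "b \<in> J" "b \<noteq> \<zero>" by auto
    with I J have c: "a \<in> carrier R" "b \<in> carrier R" by (auto simp: semiring_ideal_def)
    then have "a \<otimes> b \<in> J" "b \<otimes> a \<in> I"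
      using ab I J by (auto simp: semiring_ideal_def)
    then have "a \<otimes> b \<in> I \<inter> J" using m_comm[OF c] by simp
    then show False using that entire[OF c] ab by auto
  qed
qed auto

lemma sum_subset_zero_iff:
  assumes I: "semiring_ideal R I" and J: "semiring_ideal R J"
  shows "{i \<oplus> j | i j. i \<in> I \<and> j \<in> J} \<subseteq> {\<zero>} \<longleftrightarrow> I \<subseteq> {\<zero>} \<and> J \<subseteq> {\<zero>}" (is "?S \<subseteq> _ \<longleftrightarrow> _")
proof
  assume S: "?S \<subseteq> {\<zero>}"
  have "i = \<zero> \<and> j = \<zero>" if "i \<in> I" "j \<in> J" for i j
    using S zerosumfree[of i j] that I J by (auto simp: semiring_ideal_def)
  \<comment> \<open>Both ideals contain zero, so every element of one has a partner in the
    other.\<close>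
  then show "I \<subseteq> {\<zero>} \<and> J \<subseteq> {\<zero>}"
    using zero_mem_ideal[OF I] zero_mem_ideal[OF J] by blast
next
  assume "I \<subseteq> {\<zero>} \<and> J \<subseteq> {\<zero>}"
  then show "?S \<subseteq> {\<zero>}" by (auto dest!: subsetD)
qed

section \<open>The subtractive closure in the austere case\<close>

context
  assumes austere: "austere R"
begin

lemma scl_ideal:
  assumes "semiring_ideal R I"
  shows "scl R I = (if I \<subseteq> {\<zero>} then {\<zero>} else carrier R)"
  using scl_austere[OF austere zero_closed] assms by (auto simp: semiring_ideal_def)

lemma semiring_ideal_scl: "semiring_ideal R I \<Longrightarrow> semiring_ideal R (scl R I)"
  by (simp add: scl_ideal semiring_ideal_zero semiring_ideal_carrier)

lemma subset_scl: "I \<subseteq> scl R I"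
  by (auto simp: scl_def)

text \<open>Selects the second case of \<open>scl_ideal\<close> when the closure is applied to the
  whole carrier.\<close>

lemma carrier_not_subset_zero: "\<not> carrier R \<subseteq> {\<zero>}"
  using one_not_zero one_closed by blast

lemma scl_idem: "semiring_ideal R I \<Longrightarrow> scl R (scl R I) = scl R I"
  by (simp add: scl_ideal semiring_ideal_zero semiring_ideal_carrier carrier_not_subset_zero)

text \<open>Both sides of the join equation depend only on which of \<open>I\<close> and
  \<open>J\<close> are zero; zerosumfreeness makes the join zero only if both are.\<close>

lemma kuratowski_austere: "kuratowski R"
proof -
  interpret L: lattice "ideal_order R"
    by (rule lattice_ideal_order[OF semiring_axioms comm_monoid_axioms])
  note join = join_ideal_order[OF semiring_axioms comm_monoid_axioms]
  note bottom = bottom_ideal_order[OF semiring_axioms comm_monoid_axioms]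
  have "scl R (I \<squnion>\<^bsub>ideal_order R\<^esub> J) = scl R I \<squnion>\<^bsub>ideal_order R\<^esub> scl R J"
    if IJ: "semiring_ideal R I" "semiring_ideal R J" for I J
  proof -
    have "semiring_ideal R (I \<squnion>\<^bsub>ideal_order R\<^esub> J)"
      using L.join_closed[of I J] IJ by simp
    then have "scl R (I \<squnion>\<^bsub>ideal_order R\<^esub> J)
        = (if I \<subseteq> {\<zero>} \<and> J \<subseteq> {\<zero>} then {\<zero>} else carrier R)"
      by (simp add: scl_ideal join[OF IJ] sum_subset_zero_iff[OF IJ])
    \<comment> \<open>The carrier is the top ideal and hence absorbing for joins.\<close>
    moreover have "carrier R \<squnion>\<^bsub>ideal_order R\<^esub> K = carrier R"
      and "K \<squnion>\<^bsub>ideal_order R\<^esub> carrier R = carrier R"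
      if K: "semiring_ideal R K" for K
    proof -
      have "carrier R \<subseteq> carrier R \<squnion>\<^bsub>ideal_order R\<^esub> K"
        "carrier R \<squnion>\<^bsub>ideal_order R\<^esub> K \<subseteq> carrier R"
        using L.join_left[of "carrier R" K] L.join_closed[of "carrier R" K] K semiring_ideal_carrier
        by (simp_all add: semiring_ideal_def)
      then show "carrier R \<squnion>\<^bsub>ideal_order R\<^esub> K = carrier R" by simp
      \<comment> \<open>A join is the supremum of an unordered pair, so the arguments may be
        swapped.\<close>
      then show "K \<squnion>\<^bsub>ideal_order R\<^esub> carrier R = carrier R"
        by (simp add: join_def insert_commute)
    qed
    moreover have "{\<zero>} \<squnion>\<^bsub>ideal_order R\<^esub> {\<zero>} = {\<zero>}"
      by (simp add: join semiring_ideal_zero)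
    ultimately show ?thesis
      by (simp add: scl_ideal IJ semiring_ideal_zero semiring_ideal_carrier)
  qed
  moreover have "weak_partial_order_bottom (ideal_order R)"
    by unfold_locales (use least_ideal_order[OF semiring_axioms comm_monoid_axioms] in auto)
  moreover have "scl R {\<zero>} = {\<zero>}"
    by (simp add: scl_ideal semiring_ideal_zero)
  ultimately show ?thesis
    unfolding kuratowski_def kuratowski_map_def kuratowski_map_axioms_def
    using L.upper_semilattice_axioms
    by (simp add: Pi_iff semiring_ideal_scl subset_scl scl_idem bottom)
qed

lemma nucleus_austere: "nucleus R"
proof -
  interpret L: lattice "ideal_order R"
    by (rule lattice_ideal_order[OF semiring_axioms comm_monoid_axioms])
  note meet = meet_ideal_order[OF semiring_axioms comm_monoid_axioms]
  have "scl R (I \<sqinter>\<^bsub>ideal_order R\<^esub> J) = scl R I \<sqinter>\<^bsub>ideal_order R\<^esub> scl R J"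
    if IJ: "semiring_ideal R I" "semiring_ideal R J" for I J
  proof -
    have "semiring_ideal R (I \<sqinter>\<^bsub>ideal_order R\<^esub> J)"
      using L.meet_closed[of I J] IJ by simp
    then have "scl R (I \<sqinter>\<^bsub>ideal_order R\<^esub> J)
        = (if I \<subseteq> {\<zero>} \<or> J \<subseteq> {\<zero>} then {\<zero>} else carrier R)"
      by (simp add: scl_ideal meet[OF IJ] inter_subset_zero_iff[OF IJ])
    \<comment> \<open>The meet becomes an intersection while the closures are still folded, so that
      \<open>semiring_ideal_scl\<close> discharges the side conditions; only then are the closures
      evaluated.\<close>
    then show ?thesis
      by (simp add: meet semiring_ideal_scl IJ) (simp add: scl_ideal IJ)
  qed
  then show ?thesis
    unfolding nucleus_def nucleus_map_def nucleus_map_axioms_def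
    using L.lower_semilattice_axioms
    by (simp add: Pi_iff semiring_ideal_scl subset_scl scl_idem)
qed

text \<open>Both sides are zero if \<open>I\<close> or \<open>J\<close> is, and the whole carrier
  otherwise, by \<open>ideal_mult_carrier\<close>.\<close>

lemma scl_ideal_mult:
  assumes IJ: "semiring_ideal R I" "semiring_ideal R J"
  shows "ideal_mult R (scl R I) (scl R J) = scl R (ideal_mult R I J)"
proof -
  have zero: "ideal_mult R K L = {\<zero>}"
    if "semiring_ideal R K" "semiring_ideal R L" "K \<subseteq> {\<zero>} \<or> L \<subseteq> {\<zero>}" for K L
  proof
    show "ideal_mult R K L \<subseteq> {\<zero>}"
      using that ideal_mult_subset_zero_iff by blast
    show "{\<zero>} \<subseteq> ideal_mult R K L"
      using mult_mem_ideal_mult[of \<zero> K \<zero> L] that by (simp add: zero_mem_ideal)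
  qed
  have "ideal_mult R I J \<subseteq> carrier R"
    using IJ by (intro ideal_mult_subset_carrier) (auto simp: semiring_ideal_def)
  then have "scl R (ideal_mult R I J) = (if I \<subseteq> {\<zero>} \<or> J \<subseteq> {\<zero>} then {\<zero>} else carrier R)"
    by (simp add: scl_austere[OF austere] ideal_mult_subset_zero_iff[OF IJ])
  then show ?thesis
    by (simp add: scl_ideal IJ zero semiring_ideal_zero semiring_ideal_carrier ideal_mult_carrier)
qed

end

end

section \<open>The max-plus algebra\<close>

lemma max_plus_simps [simp]:
  "carrier max_plus = range Fin \<union> {Minf}" "x \<otimes>\<^bsub>max_plus\<^esub> y = x + y" "\<one>\<^bsub>max_plus\<^esub> = Fin 0"
  "\<zero>\<^bsub>max_plus\<^esub> = Minf" "x \<oplus>\<^bsub>max_plus\<^esub> y = max x y"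
  by (simp_all add: max_plus_def)

lemma Minf_max [simp]: "max Minf x = x" "max x Minf = x" for x :: "'a::linorder extended"
  by (cases x; simp add: max_def)+

lemma Fin_max [simp]: "max (Fin a) (Fin b) = Fin (max a b)" for a :: "'a::linorder"
  by (simp add: max_def)

lemma mem_max_plus_ideal [simp]:
  "Fin k \<in> max_plus_ideal n \<longleftrightarrow> n \<le> k" "Minf \<in> max_plus_ideal n" "Pinf \<notin> max_plus_ideal n"
  by (auto simp: max_plus_ideal_def)

lemma information_algebra_max_plus: "information_algebra max_plus"
  by unfold_locales (auto simp: ac_simps max_def split: if_splits)

section \<open>Ideals of the max-plus algebra\<close>

lemma semiring_ideal_max_plus_ideal: "semiring_ideal max_plus (max_plus_ideal n)"
  unfolding semiring_ideal_def by (auto simp: max_plus_ideal_def)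

text \<open>Multiplying by \<open>Fin d\<close> shifts by \<open>d\<close>, so a nonzero ideal is
  determined by its least finite element.\<close>

lemma semiring_ideal_max_plus_iff:
  "semiring_ideal max_plus I \<longleftrightarrow> I \<in> range max_plus_ideal \<union> {{Minf}}"
proof
  interpret information_algebra max_plus by (rule information_algebra_max_plus)
  show "semiring_ideal max_plus I" if "I \<in> range max_plus_ideal \<union> {{Minf}}"
    using that semiring_ideal_max_plus_ideal semiring_ideal_zero by auto
  assume I: "semiring_ideal max_plus I"
  have M: "Minf \<in> I" using zero_mem_ideal[OF I] by simp
  have sub: "I \<subseteq> range Fin \<union> {Minf}" using I by (simp add: semiring_ideal_def)
  show "I \<in> range max_plus_ideal \<union> {{Minf}}"
  proof (cases "\<exists>n. Fin n \<in> I")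
    case False
    then show ?thesis using M sub by auto
  next
    case True
    define n where "n = (LEAST n. Fin n \<in> I)"
    have n: "Fin n \<in> I" using True unfolding n_def by (rule LeastI_ex)
    have least: "n \<le> k" if "Fin k \<in> I" for k
      unfolding n_def using that by (rule Least_le)
    have up: "Fin k \<in> I" if "n \<le> k" for k
    proof -
      \<comment> \<open>The multiplier shifts \<open>Fin n\<close> to \<open>Fin k\<close>;
        truncated subtraction is exact because \<open>n \<le> k\<close>.\<close>
      have "Fin (k - n) \<otimes>\<^bsub>max_plus\<^esub> Fin n \<in> I"
        using I n unfolding semiring_ideal_def by (metis UnI1 max_plus_simps(1) rangeI)
      then show ?thesis using that by simp
    qed
    have "I = max_plus_ideal n"
      using M sub least up by (auto simp: max_plus_ideal_def)
    then show ?thesis by simp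
  qed
qed

lemma max_plus_ideal_subset_iff: "max_plus_ideal m \<subseteq> max_plus_ideal n \<longleftrightarrow> n \<le> m"
  by (auto simp: max_plus_ideal_def)

lemma max_plus_ideal_0: "max_plus_ideal 0 = carrier max_plus"
  by (auto simp: max_plus_ideal_def)

lemma austere_max_plus: "austere max_plus"
proof -
  have "subtractive_ideal max_plus I \<longleftrightarrow> I = {Minf} \<or> I = carrier max_plus" for I
  proof
    assume I: "subtractive_ideal max_plus I"
    have sub: "y \<in> I" if "x \<in> carrier max_plus" "y \<in> carrier max_plus"
      "x \<oplus>\<^bsub>max_plus\<^esub> y \<in> I" "x \<in> I" for x y
      using I that unfolding subtractive_ideal_def by blast
    have "I \<in> range max_plus_ideal \<union> {{Minf}}"
      using I semiring_ideal_max_plus_iff unfolding subtractive_ideal_def by blast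
    then consider "I = {Minf}" | n where "I = max_plus_ideal n" by auto
    then show "I = {Minf} \<or> I = carrier max_plus"
    proof cases
      case 2
      \<comment> \<open>The maximum of \<open>Fin n\<close> and \<open>Fin 0\<close> is
        \<open>Fin n\<close>, which lies in \<open>I\<close>; subtractivity then puts
        \<open>Fin 0\<close> into \<open>I\<close>, that is, \<open>n \<le> 0\<close>.\<close>
      with sub[of "Fin n" "Fin 0"] have "n = 0" by simp
      with 2 show ?thesis by (simp add: max_plus_ideal_0 del: max_plus_simps)
    qed simp
  next
    interpret information_algebra max_plus by (rule information_algebra_max_plus)
    assume "I = {Minf} \<or> I = carrier max_plus"
    then show "subtractive_ideal max_plus I"
      using semiring_ideal_zero semiring_ideal_carrier
      by (auto simp: subtractive_ideal_def max_def split: if_splits)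
  qed
  then show ?thesis by (auto simp: austere_def)
qed

text \<open>Comparability is inherited, with order reversed, from the linear order on the indices;
  the zero ideal lies below everything.\<close>

lemma total_order_ideal_order_max_plus: "total_order (ideal_order max_plus)"
proof -
  interpret partial_order "ideal_order max_plus" by (rule partial_order_ideal_order)
  show ?thesis
  proof (rule total_orderI)
    fix I J assume "I \<in> carrier (ideal_order max_plus)" "J \<in> carrier (ideal_order max_plus)"
    then have "I = {Minf} \<or> (\<exists>m. I = max_plus_ideal m)" "J = {Minf} \<or> (\<exists>n. J = max_plus_ideal n)"
      by (auto simp: semiring_ideal_max_plus_iff)
    then show "I \<sqsubseteq>\<^bsub>ideal_order max_plus\<^esub> J \<or> J \<sqsubseteq>\<^bsub>ideal_order max_plus\<^esub> I"
      by (elim disjE exE) (simp_all add: max_plus_ideal_subset_iff nat_le_linear)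
  qed
qed

theorem theorem5p9:
  shows "{I. semiring_ideal max_plus I} = range max_plus_ideal \<union> {{Minf}}
    \<and> total_order (ideal_order max_plus)
    \<and> (\<forall>n. {Minf} \<subset> max_plus_ideal n)
    \<and> (\<forall>m n. m < n \<longrightarrow> max_plus_ideal n \<subset> max_plus_ideal m)
    \<and> max_plus_ideal 0 = carrier max_plus
    \<and> kuratowski max_plus
    \<and> nucleus max_plus
    \<and> austere max_plus
    \<and> information_algebra max_plus
    \<and> (\<forall>I J. semiring_ideal max_plus I \<longrightarrow> semiring_ideal max_plus J \<longrightarrow>
         ideal_mult max_plus (scl max_plus I) (scl max_plus J)
           = scl max_plus (ideal_mult max_plus I J))"
proof (intro conjI allI impI)
  show "{I. semiring_ideal max_plus I} = range max_plus_ideal \<union> {{Minf}}"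
    using semiring_ideal_max_plus_iff by blast
  show "{Minf} \<subset> max_plus_ideal n" for n
    by (auto simp: max_plus_ideal_def)
  show "max_plus_ideal n \<subset> max_plus_ideal m" if "m < n" for m n
    using that by (simp add: less_le_not_le max_plus_ideal_subset_iff)
  \<comment> \<open>Lemmas exported from the locale expect the locale predicate first and austerity
    second.\<close>
  note austere = information_algebra_max_plus austere_max_plus
  show "kuratowski max_plus"
    using austere by (rule information_algebra.kuratowski_austere)
  show "nucleus max_plus"
    using austere by (rule information_algebra.nucleus_austere)
  show "ideal_mult max_plus (scl max_plus I) (scl max_plus J)
      = scl max_plus (ideal_mult max_plus I J)"
    if "semiring_ideal max_plus I" "semiring_ideal max_plus J" for I J
    using austere that by (rule information_algebra.scl_ideal_mult)
qed (rule total_order_ideal_order_max_plus max_plus_ideal_0 austere_max_plus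
    information_algebra_max_plus)+

end
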